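(* For every $n\in\mathbb{N}$, the preorder $T_n^*$ on the vertices of the twisted cube $T_n$ is isomorphic to the total order $(\{0,1\}^{n},<)$ (equivalently, to the total order on $2^n$ elements); in particular it is a total order (antisymmetric and total).
   Context: A graph is $(V,E)$ with $E\subseteq V\times V$. For a graph $G$, $G^*$ is the preorder on its vertices with $u\le v$ iff there is a directed chain of edges from $u$ to $v$. The twisted $n$-cube $T_n$ is the graph with vertex set $\{0,1\}^n$ (sequences $x_0x_1\cdots x_{n-1}$) and edges: a loop at each vertex, and for each $i\in\{0,\dots,n-1\}$ and each $y=y_0\cdots y_{n-2}\in\{0,1\}^{n-1}$ an edge from $y_0\cdots y_{i-1}\,b\,y_i\cdots y_{n-2}$ to $y_0\cdots y_{i-1}\,(1-b)\,y_i\cdots y_{n-2}$, where $b=1$ if the number of zeros among $y_0,\dots,y_{i-1}$ is odd and $b=0$ otherwise. (Equivalently, $T_0$ is one vertex with a loop, and $T_{n+1}$ has vertices $\{0,1\}\times V(T_n)$ with an edge $(0,t)\to(0,s)$ and $(1,s)\to(1,t)$ for each edge $s\to t$ of $T_n$, and an edge $(0,v)\to(1,v)$ for each vertex $v$.) $(\{0,1\}^n,<)$ denotes binary sequences ordered as binary numbers. *)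

theory Defs
  imports "Graph_Theory.Pair_Digraph"
begin

text \<open>
  A bit is a \<^typ>\<open>bool\<close>, with \<^term>\<open>False\<close> for $0$ and \<^term>\<open>True\<close> for $1$; a sequence
  $x_0 x_1 \cdots x_{n-1}$ is the list \<open>x\<close> with \<open>x ! i = x_i\<close>. A graph $(V, E)$ with
  $E \subseteq V \times V$ is a \<^locale>\<open>pair_wf_digraph\<close>.
\<close>

definition bit_seqs :: "nat \<Rightarrow> bool list set" where
  "bit_seqs n = {x. length x = n}"

definition twist_bit :: "nat \<Rightarrow> bool list \<Rightarrow> bool" where
  "twist_bit i y \<longleftrightarrow> odd (card {j. j < i \<and> y ! j = False})"

definition insert_bit :: "nat \<Rightarrow> bool \<Rightarrow> bool list \<Rightarrow> bool list" where
  "insert_bit i b y = take i y @ b # drop i y"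

definition twisted_cube :: "nat \<Rightarrow> bool list pair_pre_digraph" where
  "twisted_cube n =
     \<lparr> pverts = bit_seqs n,
       parcs = {(x, x) | x. x \<in> bit_seqs n} \<union>
         {(insert_bit i (twist_bit i y) y, insert_bit i (\<not> twist_bit i y) y) | i y.
            i < n \<and> y \<in> bit_seqs (n - 1)} \<rparr>"

lemma pair_wf_digraph_twisted_cube: "pair_wf_digraph (twisted_cube n)"
  by unfold_locales (auto simp: twisted_cube_def bit_seqs_def insert_bit_def)

text \<open>The preorder $G^*$, as the set of pairs $(u, v)$ of vertices of $G$ with $u \le v$.\<close>

definition chain_preorder :: "'a pair_pre_digraph \<Rightarrow> 'a rel" where
  "chain_preorder G = {(u, v). u \<rightarrow>\<^sup>*\<^bsub>with_proj G\<^esub> v}"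

text \<open>
  Binary numbers have their most significant digit $x_0$ first, whereas \<^const>\<open>horner_sum\<close>
  expects the least significant digit first.
\<close>

definition binary_value :: "bool list \<Rightarrow> nat" where
  "binary_value x = horner_sum of_bool 2 (rev x)"

text \<open>The non-strict form of $(\{0,1\}^n, <)$, to be compared with the reflexive $T_n^*$.\<close>

definition binary_order :: "nat \<Rightarrow> bool list rel" where
  "binary_order n =
     {(x, y). x \<in> bit_seqs n \<and> y \<in> bit_seqs n \<and> binary_value x \<le> binary_value y}"

text \<open>
  \<^const>\<open>iso\<close> of the library is meant for well-orders only, so isomorphism of
  relations \<open>r\<close> on \<open>A\<close> and \<open>s\<close> on \<open>B\<close> is spelled out here.
\<close>

definition rel_isomorphic :: "'a set \<Rightarrow> 'a rel \<Rightarrow> 'b set \<Rightarrow> 'b rel \<Rightarrow> bool" where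
  "rel_isomorphic A r B s \<longleftrightarrow>
     (\<exists>f. bij_betw f A B \<and> (\<forall>u\<in>A. \<forall>v\<in>A. (u, v) \<in> r \<longleftrightarrow> (f u, f v) \<in> s))"

end

theory Submission
  imports Defs
begin

text \<open>
  Reading a vertex from the left and complementing the rest of the word after each $0$ turns
  the twisted cube recursion into binary counting: the sequence \<open>twist_decode x\<close> has as
  its binary value the position of \<open>x\<close> in $T_n^*$. Every edge but the loops increases this
  value, and consecutive values are joined by an edge, so that $T_n$ has a Hamiltonian path.
\<close>

primrec twist_decode :: "bool list \<Rightarrow> bool list" where
  "twist_decode [] = []"
| "twist_decode (b # x) = b # (if b then twist_decode x else map Not (twist_decode x))"

lemma length_twist_decode [simp]: "length (twist_decode x) = length x"
  by (induction x) auto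

lemma binary_value_Nil [simp]: "binary_value [] = 0"
  by (simp add: binary_value_def)

lemma binary_value_Cons [simp]:
  "binary_value (b # x) = of_bool b * 2 ^ length x + binary_value x"
  by (simp add: binary_value_def horner_sum_append)

lemma binary_value_less: "binary_value x < 2 ^ length x"
  by (induction x) auto

text \<open>At each position exactly one of the two words has a 1, so the sum is the all-ones
  number. Complementation therefore reverses the order of values; the additive form avoids truncated
  subtraction.\<close>

lemma binary_value_map_Not: "Suc (binary_value x + binary_value (map Not x)) = 2 ^ length x"
  by (induction x) auto

lemma binary_value_inject:
  "length x = length y \<Longrightarrow> binary_value x = binary_value y \<longleftrightarrow> x = y"
proof (induction x y rule: list_induct2)
  case (Cons b x c y)
  then show ?case
    using binary_value_less[of x] binary_value_less[of y] by (cases b; cases c) auto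
qed simp

lemma finite_bit_seqs: "finite (bit_seqs n)" and card_bit_seqs: "card (bit_seqs n) = 2 ^ n"
  using finite_lists_length_eq[of "UNIV :: bool set" n] card_lists_length_eq[of "UNIV :: bool set" n]
  by (simp_all add: bit_seqs_def card_UNIV_bool)

text \<open>Surjectivity is by counting: an injective image of \<open>bit_seqs n\<close> already has
  \<open>2 ^ n\<close> elements.\<close>

lemma bij_betw_binary_value: "bij_betw binary_value (bit_seqs n) {..<2 ^ n}"
proof -
  have inj: "inj_on binary_value (bit_seqs n)"
    by (auto simp: inj_on_def bit_seqs_def binary_value_inject)
  moreover have "binary_value ` bit_seqs n \<subseteq> {..<2 ^ n}"
    using binary_value_less by (auto simp: bit_seqs_def)
  then have "binary_value ` bit_seqs n = {..<2 ^ n}"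
    using inj by (intro card_subset_eq) (auto simp: card_image card_bit_seqs)
  ultimately show ?thesis
    by (simp add: bij_betw_def)
qed

text \<open>The leading bit survives decoding and tells whether the tail was complemented, so
  decoding can be undone from the left.\<close>

lemma twist_decode_inject: "length x = length y \<Longrightarrow> twist_decode x = twist_decode y \<longleftrightarrow> x = y"
  by (induction x y rule: list_induct2) (auto simp: inj_map_eq_map inj_def)

lemma bij_betw_twist_decode: "bij_betw twist_decode (bit_seqs n) (bit_seqs n)"
proof -
  have inj: "inj_on twist_decode (bit_seqs n)"
    by (auto simp: inj_on_def bit_seqs_def twist_decode_inject)
  moreover have "twist_decode ` bit_seqs n \<subseteq> bit_seqs n"
    by (auto simp: bit_seqs_def)
  ultimately show ?thesis
    by (simp add: bij_betw_def endo_inj_surj finite_bit_seqs)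
qed

abbreviation twist_rank :: "bool list \<Rightarrow> nat" where
  "twist_rank x \<equiv> binary_value (twist_decode x)"

lemma bij_betw_twist_rank: "bij_betw twist_rank (bit_seqs n) {..<2 ^ n}"
  using bij_betw_trans[OF bij_betw_twist_decode bij_betw_binary_value] by (simp add: comp_def)

lemma twist_rank_Cons_True: "twist_rank (True # x) = 2 ^ length x + twist_rank x"
  by simp

text \<open>A leading 0 complements the decoded tail, so the lower half of the ranks is a reversed
  copy of the smaller cube, just as in the recursion for twisted cubes.\<close>

lemma twist_rank_Cons_False: "Suc (twist_rank (False # x) + twist_rank x) = 2 ^ length x"
  using binary_value_map_Not[of "twist_decode x"] by simp

lemma twist_bit_0 [simp]: "\<not> twist_bit 0 y"
  by (simp add: twist_bit_def)

text \<open>A 0 in front adds one to the counted zeros and so reverses the edge. This turns the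
  parity definition of the edges into a recursion on the leading bit.\<close>

lemma twist_bit_Suc_Cons [simp]:
  "twist_bit (Suc i) (c # y) \<longleftrightarrow> (if c then twist_bit i y else \<not> twist_bit i y)"
proof -
  have eq: "{j. j < Suc i \<and> (c # y) ! j = False} =
      (if c then {} else {0}) \<union> Suc ` {j. j < i \<and> y ! j = False}"
    by (auto simp: less_Suc_eq_0_disj)
  show ?thesis
    unfolding twist_bit_def eq by (simp add: card_image card_insert_if image_iff)
qed

lemma insert_bit_0 [simp]: "insert_bit 0 b y = b # y"
  by (simp add: insert_bit_def)

lemma insert_bit_Suc_Cons [simp]: "insert_bit (Suc i) b (c # y) = c # insert_bit i b y"
  by (simp add: insert_bit_def)

lemma length_insert_bit [simp]: "length (insert_bit i b y) = Suc (length y)"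
  by (simp add: insert_bit_def)

text \<open>Induction on the leading bit: a 1 shifts both ranks equally, while a 0 swaps the
  endpoints and also reverses the ranks, so the two effects cancel.\<close>

lemma twist_rank_edge_less:
  "i \<le> length y \<Longrightarrow>
    twist_rank (insert_bit i (twist_bit i y) y) < twist_rank (insert_bit i (\<not> twist_bit i y) y)"
proof (induction y arbitrary: i)
  case Nil
  then show ?case by simp
next
  case (Cons c y)
  show ?case
  proof (cases i)
    case 0
    \<comment> \<open>The edge flips the leading bit from 0 to 1, hence passes from the lower to the
      upper half of the ranks.\<close>
    then show ?thesis
      using twist_rank_Cons_False[of "c # y"] twist_rank_Cons_True[of "c # y"]
      by (simp del: twist_decode.simps)
  next
    case (Suc k)
    with Cons have IH: "twist_rank (insert_bit k (twist_bit k y) y) <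
        twist_rank (insert_bit k (\<not> twist_bit k y) y)"
      by simp
    show ?thesis
    proof (cases c)
      case True
      with Suc IH show ?thesis by simp
    next
      case False
      with Suc IH twist_rank_Cons_False[of "insert_bit k (twist_bit k y) y"]
        twist_rank_Cons_False[of "insert_bit k (\<not> twist_bit k y) y"]
      show ?thesis by (simp del: twist_decode.simps)
    qed
  qed
qed

lemma pverts_twisted_cube [simp]: "pverts (twisted_cube n) = bit_seqs n"
  by (simp add: twisted_cube_def)

text \<open>The inequality is weak because of the loops.\<close>

lemma twist_rank_mono_arc:
  assumes "(u, v) \<in> parcs (twisted_cube n)"
  shows "twist_rank u \<le> twist_rank v"
  using assms twist_rank_edge_less
  by (fastforce simp: twisted_cube_def bit_seqs_def intro: less_imp_le)

lemma arc_False_True: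
  "x \<in> bit_seqs n \<Longrightarrow> (False # x, True # x) \<in> parcs (twisted_cube (Suc n))"
  by (auto simp: twisted_cube_def intro!: exI[of _ 0] exI[of _ x])

lemma arc_Cons:
  assumes "(u, v) \<in> parcs (twisted_cube n)"
  shows "(if c then (c # u, c # v) else (c # v, c # u)) \<in> parcs (twisted_cube (Suc n))"
proof -
  consider "u = v" "u \<in> bit_seqs n"
    | i y where "i < n" "y \<in> bit_seqs (n - 1)" "u = insert_bit i (twist_bit i y) y"
      "v = insert_bit i (\<not> twist_bit i y) y"
    using assms by (auto simp: twisted_cube_def)
  then show ?thesis
  proof cases
    case 1
    then show ?thesis by (simp add: twisted_cube_def bit_seqs_def)
  next
    case 2
    \<comment> \<open>Here \<open>i < n\<close> makes \<open>n\<close> positive, so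
      \<open>n - 1\<close> is not truncated and \<open>c # y\<close> has length
      \<open>n\<close>.\<close>
    then have "Suc i < Suc n" "c # y \<in> bit_seqs (Suc n - 1)" by (auto simp: bit_seqs_def)
    then have "(insert_bit (Suc i) (twist_bit (Suc i) (c # y)) (c # y),
        insert_bit (Suc i) (\<not> twist_bit (Suc i) (c # y)) (c # y)) \<in> parcs (twisted_cube (Suc n))"
      unfolding twisted_cube_def pair_pre_digraph.simps by blast
    with 2 show ?thesis by (cases c) simp_all
  qed
qed

text \<open>These arcs form the Hamiltonian path: it runs backwards through the copy with leading 0,
  crosses once, then runs forwards through the copy with leading 1.\<close>

lemma arc_if_twist_rank_Suc:
  assumes "u \<in> bit_seqs n" "v \<in> bit_seqs n" "twist_rank v = Suc (twist_rank u)"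
  shows "(u, v) \<in> parcs (twisted_cube n)"
  using assms
proof (induction n arbitrary: u v)
  case 0
  then show ?case by (simp add: bit_seqs_def)
next
  case (Suc n)
  \<comment> \<open>Decoding stays folded so that the rank equations for \<open>#\<close>
    apply.\<close>
  note [simp del] = twist_decode.simps
  from Suc.prems obtain b x c y where uv: "u = b # x" "v = c # y"
    and len: "length x = n" "length y = n"
    by (auto simp: bit_seqs_def length_Suc_conv)
  note ranks = twist_rank_Cons_True twist_rank_Cons_False[of x] twist_rank_Cons_False[of y]
  have less: "twist_rank x < 2 ^ n" "twist_rank y < 2 ^ n"
    using binary_value_less[of "twist_decode x"] binary_value_less[of "twist_decode y"] len
    by simp_all
  consider "b" "c" | "\<not> b" "\<not> c" | "\<not> b" "c" | "b" "\<not> c" by blast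
  then show ?case
  proof cases
    case 1
    with Suc.prems uv len ranks have "twist_rank y = Suc (twist_rank x)" by simp
    with Suc.IH len have "(x, y) \<in> parcs (twisted_cube n)" by (simp add: bit_seqs_def)
    with 1 uv show ?thesis using arc_Cons[of x y _ True] by simp
  next
    case 2
    with Suc.prems uv len ranks have "twist_rank x = Suc (twist_rank y)" by simp
    with Suc.IH len have "(y, x) \<in> parcs (twisted_cube n)" by (simp add: bit_seqs_def)
    with 2 uv show ?thesis using arc_Cons[of y x _ False] by simp
  next
    case 3
    \<comment> \<open>The crossing goes from rank \<open>2 ^ n - 1\<close> to rank
      \<open>2 ^ n\<close>, which forces both tails to have rank 0.\<close>
    with Suc.prems uv len ranks have "twist_rank x = twist_rank y" by simp
    with len have "x = y" by (simp add: binary_value_inject twist_decode_inject)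
    with 3 uv len show ?thesis using arc_False_True[of x n] by (simp add: bit_seqs_def)
  next
    case 4
    \<comment> \<open>Impossible: the rank would have to drop from the upper to the lower
      half.\<close>
    with Suc.prems uv len ranks less show ?thesis by simp
  qed
qed

lemma chain_preorder_twisted_cube:
  "chain_preorder (twisted_cube n) =
    {(u, v). u \<in> bit_seqs n \<and> v \<in> bit_seqs n \<and> twist_rank u \<le> twist_rank v}"
proof -
  interpret pair_wf_digraph "twisted_cube n" by (rule pair_wf_digraph_twisted_cube)
  have sound: "u \<in> bit_seqs n \<and> v \<in> bit_seqs n \<and> twist_rank u \<le> twist_rank v"
    if "u \<rightarrow>\<^sup>*\<^bsub>with_proj (twisted_cube n)\<^esub> v" for u v
    using that
  proof induction
    case base
    then show ?case by simp
  next
    case (step u w)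
    then have "(u, w) \<in> parcs (twisted_cube n)" by simp
    with step show ?case
      using twist_rank_mono_arc[of u w n] in_arcsD1[of u w] by simp
  qed
  \<comment> \<open>The path is climbed one rank at a time, by induction on the gap
    \<open>k\<close>.\<close>
  have complete: "u \<rightarrow>\<^sup>*\<^bsub>with_proj (twisted_cube n)\<^esub> v"
    if "u \<in> bit_seqs n" "v \<in> bit_seqs n" "twist_rank v = twist_rank u + k" for u v k
    using that
  proof (induction k arbitrary: v)
    case 0
    then have "u = v"
      using bij_betw_imp_inj_on[OF bij_betw_twist_rank[of n]] by (auto dest: inj_onD)
    with 0 show ?case by simp
  next
    case (Suc k)
    \<comment> \<open>This bound puts the rank just below that of \<open>v\<close> in the range of
      \<open>twist_rank\<close>, which yields the predecessor \<open>w\<close>.\<close>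
    have "twist_rank v < 2 ^ n"
      using Suc.prems bij_betw_twist_rank[of n] by (auto dest: bij_betw_apply)
    with Suc.prems have "twist_rank u + k \<in> {..<2 ^ n}" by simp
    then obtain w where w: "w \<in> bit_seqs n" "twist_rank w = twist_rank u + k"
      using bij_betw_imp_surj_on[OF bij_betw_twist_rank[of n]] by (metis imageE)
    with Suc have "u \<rightarrow>\<^sup>*\<^bsub>with_proj (twisted_cube n)\<^esub> w" by blast
    moreover have "(w, v) \<in> parcs (twisted_cube n)"
      using Suc.prems w by (intro arc_if_twist_rank_Suc) auto
    ultimately show ?case
      by (auto intro: reachable_adj_trans)
  qed
  have "u \<rightarrow>\<^sup>*\<^bsub>with_proj (twisted_cube n)\<^esub> v \<longleftrightarrow>
      u \<in> bit_seqs n \<and> v \<in> bit_seqs n \<and> twist_rank u \<le> twist_rank v" for u v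
    using sound[of u v] complete[of u v] le_Suc_ex by blast
  then show ?thesis
    by (simp add: chain_preorder_def)
qed

theorem theorem3p5:
  fixes n :: nat
  shows "rel_isomorphic (pverts (twisted_cube n)) (chain_preorder (twisted_cube n))
           (bit_seqs n) (binary_order n) \<and>
         rel_isomorphic (pverts (twisted_cube n)) (chain_preorder (twisted_cube n))
           {..<2 ^ n :: nat} {(a, b). a < 2 ^ n \<and> b < 2 ^ n \<and> a \<le> b} \<and>
         linear_order_on (pverts (twisted_cube n)) (chain_preorder (twisted_cube n))"
proof (intro conjI)
  show "rel_isomorphic (pverts (twisted_cube n)) (chain_preorder (twisted_cube n))
      (bit_seqs n) (binary_order n)"
    unfolding rel_isomorphic_def chain_preorder_twisted_cube binary_order_def
    using bij_betw_twist_decode[of n]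
    by (auto intro!: exI[of _ twist_decode] dest: bij_betw_apply)
  show "rel_isomorphic (pverts (twisted_cube n)) (chain_preorder (twisted_cube n))
      {..<2 ^ n :: nat} {(a, b). a < 2 ^ n \<and> b < 2 ^ n \<and> a \<le> b}"
    unfolding rel_isomorphic_def chain_preorder_twisted_cube
    using bij_betw_twist_rank[of n]
    by (auto intro!: exI[of _ twist_rank] dest: bij_betw_apply)
  \<comment> \<open>The order is pulled back from the natural numbers along
    \<open>twist_rank\<close>; antisymmetry is the injectivity of the rank.\<close>
  show "linear_order_on (pverts (twisted_cube n)) (chain_preorder (twisted_cube n))"
    unfolding chain_preorder_twisted_cube order_on_defs
    using bij_betw_imp_inj_on[OF bij_betw_twist_rank[of n]]
    by (auto simp: refl_on_def total_on_def intro!: transI antisymI dest: inj_onD)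
qed

end
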